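(* $\Gamma_{4,4}\ne\Sigma_{4,4}$; that is, there exists a matrix in $\mathcal{H}(2)\otimes\mathcal{S}(4)$ which fulfills the PPT condition but is not $H_+(2)\otimes S_+(4)$-separable.
   Context: $\mathcal{S}(4)$ is the real vector space of real symmetric $4\times4$ matrices, $S_+(4)$ its cone of positive semidefinite (PSD) matrices; $\mathcal{H}(N)$ is the real vector space of complex hermitian $N\times N$ matrices, $H_+(N)$ its PSD cone. The (real) tensor product $\mathcal{H}(2)\otimes\mathcal{S}(4)$ is regarded as a subspace of $\mathcal{H}(8)$ via the Kronecker product; it consists of the complex hermitian $8\times 8$ matrices $\begin{pmatrix}B_{11}&B_{12}\\ B_{21}&B_{22}\end{pmatrix}$ whose four $4\times4$ blocks are all symmetric. The partial transpose of such a matrix is $\begin{pmatrix}B_{11}&B_{21}\\ B_{12}&B_{22}\end{pmatrix}$; the matrix fulfills the PPT condition if it and its partial transpose are both PSD. $\Gamma_{4,4}$ is the cone of PPT matrices in $\mathcal{H}(2)\otimes\mathcal{S}(4)$. A matrix is $H_+(2)\otimes S_+(4)$-separable if it is a finite sum $\sum_l A_l\otimes B_l$ with $A_l\in H_+(2)$, $B_l\in S_+(4)$; $\Sigma_{4,4}$ is the cone of such matrices. *)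

theory Defs
  imports "HOL-Analysis.Analysis"
begin

definition herm :: "(complex^'n^'n) set" where
  "herm = {A. \<forall>i j. A $ j $ i = cnj (A $ i $ j)}"

definition sym_real :: "(real^'n^'n) set" where
  "sym_real = {B. transpose B = B}"

text \<open>The form \<open>v\<^sup>* A v\<close> is real for hermitian \<open>A\<close>, so \<open>Re\<close> loses no information.\<close>

definition herm_psd :: "(complex^'n^'n) set" where
  "herm_psd = {A \<in> herm. \<forall>v. 0 \<le> Re (\<Sum>i\<in>UNIV. cnj (v $ i) * (A *v v) $ i)}"

definition sym_psd :: "(real^'n^'n) set" where
  "sym_psd = {B \<in> sym_real. \<forall>v. 0 \<le> v \<bullet> (B *v v)}"

text \<open>Rows and columns of the Kronecker product are indexed by pairs, so that
  an \<open>8 \<times> 8\<close> matrix has index type \<open>2 \<times> 4\<close>: the first component selects the block,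
  the second one the position inside the block.\<close>

definition kron ::
    "complex^'n^'n \<Rightarrow> real^'m^'m \<Rightarrow> complex^('n::finite \<times> 'm::finite)^('n \<times> 'm)"
    (infixl "\<otimes>\<^sub>K" 70) where
  "A \<otimes>\<^sub>K B = (\<chi> p q. A $ fst p $ fst q * of_real (B $ snd p $ snd q))"

text \<open>The span is over the reals.\<close>

definition herm_tensor_sym :: "(complex^('n::finite \<times> 'm::finite)^('n \<times> 'm)) set" where
  "herm_tensor_sym = span {A \<otimes>\<^sub>K B | A B. A \<in> herm \<and> B \<in> sym_real}"

definition block :: "complex^('n::finite \<times> 'm::finite)^('n \<times> 'm) \<Rightarrow> 'n \<Rightarrow> 'n \<Rightarrow> complex^'m^'m" where
  "block M i j = (\<chi> k l. M $ (i, k) $ (j, l))"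

text \<open>The blocks are interchanged, but not transposed themselves.\<close>

definition partial_transpose ::
    "complex^('n::finite \<times> 'm::finite)^('n \<times> 'm) \<Rightarrow> complex^('n \<times> 'm)^('n \<times> 'm)" where
  "partial_transpose M = (\<chi> p q. block M (fst q) (fst p) $ snd p $ snd q)"

definition ppt :: "complex^('n::finite \<times> 'm::finite)^('n \<times> 'm) \<Rightarrow> bool" where
  "ppt M \<longleftrightarrow> M \<in> herm_psd \<and> partial_transpose M \<in> herm_psd"

definition separable :: "complex^('n::finite \<times> 'm::finite)^('n \<times> 'm) \<Rightarrow> bool" where
  "separable M \<longleftrightarrow> (\<exists>(r::nat) A B. (\<forall>l<r. A l \<in> herm_psd \<and> B l \<in> sym_psd) \<and>
     M = (\<Sum>l<r. A l \<otimes>\<^sub>K B l))"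

definition Gamma44 :: "(complex^(2 \<times> 4)^(2 \<times> 4)) set" where
  "Gamma44 = {M \<in> herm_tensor_sym. ppt M}"

definition Sigma44 :: "(complex^(2 \<times> 4)^(2 \<times> 4)) set" where
  "Sigma44 = {M. separable M}"

lemma block_partial_transpose: "block (partial_transpose M) i j = block M j i"
  by (simp add: block_def partial_transpose_def vec_eq_iff)

lemma block_kron: "block (A \<otimes>\<^sub>K B) i j = (\<chi> k l. A $ i $ j * of_real (B $ k $ l))"
  by (simp add: block_def kron_def vec_eq_iff)

lemma herm_tensor_sym_iff:
  fixes M :: "complex^('n::finite \<times> 'm::finite)^('n \<times> 'm)"
  shows "M \<in> herm_tensor_sym \<longleftrightarrow> M \<in> herm \<and> (\<forall>i j. transpose (block M i j) = block M i j)"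
proof -
  let ?P = "\<lambda>M :: complex^('n \<times> 'm)^('n \<times> 'm).
    M \<in> herm \<and> (\<forall>i j. transpose (block M i j) = block M i j)"
  have hermD: "A $ j $ i = cnj (A $ i $ j)" if "A \<in> herm" for A :: "complex^'k^'k" and i j
    using that unfolding herm_def by blast
  have hermI: "A \<in> herm" if "\<And>i j. A $ j $ i = cnj (A $ i $ j)" for A :: "complex^'k^'k"
    using that unfolding herm_def by blast
  have block_sym: "(\<forall>i j. transpose (block M i j) = block M i j) \<longleftrightarrow>
      (\<forall>i j k l. M $ (i, l) $ (j, k) = M $ (i, k) $ (j, l))"
    for M :: "complex^('n \<times> 'm)^('n \<times> 'm)"
    unfolding block_def transpose_def vec_eq_iff vec_lambda_beta by blast
  have "subspace {M. ?P M}"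
    unfolding block_sym
  proof (rule subspaceI)
    show "0 \<in> {M :: complex^('n \<times> 'm)^('n \<times> 'm).
        M \<in> herm \<and> (\<forall>i j k l. M $ (i, l) $ (j, k) = M $ (i, k) $ (j, l))}"
      by (simp add: herm_def)
  next
    fix X Y assume X: "X \<in> {M :: complex^('n \<times> 'm)^('n \<times> 'm).
        M \<in> herm \<and> (\<forall>i j k l. M $ (i, l) $ (j, k) = M $ (i, k) $ (j, l))}"
      and Y: "Y \<in> {M :: complex^('n \<times> 'm)^('n \<times> 'm).
        M \<in> herm \<and> (\<forall>i j k l. M $ (i, l) $ (j, k) = M $ (i, k) $ (j, l))}"
    have "X + Y \<in> herm"
    proof (rule hermI)
      fix i j show "(X + Y) $ j $ i = cnj ((X + Y) $ i $ j)"
        using X Y hermD[of X j i] hermD[of Y j i] by simp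
    qed
    moreover have "(X + Y) $ (i, l) $ (j, k) = (X + Y) $ (i, k) $ (j, l)" for i j k l
    proof -
      have "X $ (i, l) $ (j, k) = X $ (i, k) $ (j, l)" "Y $ (i, l) $ (j, k) = Y $ (i, k) $ (j, l)"
        using X Y by blast+
      then show ?thesis by simp
    qed
    ultimately show "X + Y \<in> {M. M \<in> herm \<and> (\<forall>i j k l. M $ (i, l) $ (j, k) = M $ (i, k) $ (j, l))}"
      by blast
  next
    fix c X assume X: "X \<in> {M :: complex^('n \<times> 'm)^('n \<times> 'm).
        M \<in> herm \<and> (\<forall>i j k l. M $ (i, l) $ (j, k) = M $ (i, k) $ (j, l))}"
    have "c *\<^sub>R X \<in> herm"
    proof (rule hermI)
      fix i j show "(c *\<^sub>R X) $ j $ i = cnj ((c *\<^sub>R X) $ i $ j)"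
        using X hermD[of X j i] by simp
    qed
    moreover have "(c *\<^sub>R X) $ (i, l) $ (j, k) = (c *\<^sub>R X) $ (i, k) $ (j, l)" for i j k l
    proof -
      have "X $ (i, l) $ (j, k) = X $ (i, k) $ (j, l)"
        using X by blast
      then show ?thesis by simp
    qed
    ultimately show "c *\<^sub>R X \<in> {M. M \<in> herm \<and> (\<forall>i j k l. M $ (i, l) $ (j, k) = M $ (i, k) $ (j, l))}"
      by blast
  qed
  moreover have "?P (A \<otimes>\<^sub>K B)" if A: "A \<in> herm" and B: "B \<in> sym_real"
    for A :: "complex^'n^'n" and B :: "real^'m^'m"
  proof -
    have b: "B $ k $ l = B $ l $ k" for k l
      using B unfolding sym_real_def transpose_def vec_eq_iff vec_lambda_beta by blast
    have "A \<otimes>\<^sub>K B \<in> herm"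
    proof (rule hermI)
      fix p q
      show "(A \<otimes>\<^sub>K B) $ q $ p = cnj ((A \<otimes>\<^sub>K B) $ p $ q)"
        using hermD[OF A, of "fst q" "fst p"] b[of "snd p" "snd q"] by (simp add: kron_def)
    qed
    moreover have "(A \<otimes>\<^sub>K B) $ (i, l) $ (j, k) = (A \<otimes>\<^sub>K B) $ (i, k) $ (j, l)" for i j k l
      using b[of k l] by (simp add: kron_def)
    ultimately show ?thesis
      unfolding block_sym by blast
  qed
  then have "{A \<otimes>\<^sub>K B | A B. A \<in> herm \<and> B \<in> sym_real} \<subseteq> {M. ?P M}"
    by blast
  ultimately have 1: "M \<in> herm_tensor_sym \<Longrightarrow> ?P M"
    unfolding herm_tensor_sym_def using span_minimal by blast
  have 2: "M \<in> herm_tensor_sym" if M: "?P M"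
  proof -
    have h: "M $ (j, l) $ (i, k) = cnj (M $ (i, k) $ (j, l))" for i j k l
      using M hermD by blast
    have s: "M $ (i, l) $ (j, k) = M $ (i, k) $ (j, l)" for i j k l
      using M unfolding block_sym by blast
    define C where "C k l = (\<chi> i j. M $ (i, k) $ (j, l))" for k l
    define E :: "'m \<Rightarrow> 'm \<Rightarrow> real^'m^'m" where
      "E k l = (\<chi> a b. ((if a = k then if b = l then 1 else 0 else 0)
                       + (if a = l then if b = k then 1 else 0 else 0)) / 2)" for k l
    have C: "C k l \<in> herm" for k l
    proof (rule hermI)
      fix i j show "C k l $ j $ i = cnj (C k l $ i $ j)"
        using h[of i k j l] s[of j l i k] by (simp add: C_def)
    qed
    have E: "E k l \<in> sym_real" for k l
      by (auto simp: E_def sym_real_def transpose_def vec_eq_iff)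
    have "M $ (i, a) $ (j, b) = (\<Sum>k\<in>UNIV. \<Sum>l\<in>UNIV. C k l \<otimes>\<^sub>K E k l) $ (i, a) $ (j, b)"
      for i a j b
    proof -
      have "C k l $ i $ j * of_real (E k l $ a $ b) =
          (if a = k then if b = l then M $ (i, a) $ (j, b) / 2 else 0 else 0)
        + (if b = k then if a = l then M $ (i, a) $ (j, b) / 2 else 0 else 0)" for k l
        using s[of i a j b] by (auto simp: C_def E_def)
      moreover have "(\<Sum>l\<in>UNIV. if a = k then if b = l then c else 0 else 0)
          = (if a = k then c else 0)" for a b k :: 'm and c :: complex
        by simp
      ultimately show ?thesis
        by (simp add: kron_def sum.distrib)
    qed
    then have "M = (\<Sum>k\<in>UNIV. \<Sum>l\<in>UNIV. C k l \<otimes>\<^sub>K E k l)"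
      by (simp add: vec_eq_iff)
    moreover have "(\<Sum>k\<in>UNIV. \<Sum>l\<in>UNIV. C k l \<otimes>\<^sub>K E k l) \<in> herm_tensor_sym"
      unfolding herm_tensor_sym_def
    proof (intro span_sum span_base)
      show "C k l \<otimes>\<^sub>K E k l \<in> {A \<otimes>\<^sub>K B | A B. A \<in> herm \<and> B \<in> sym_real}" for k l
        using C E by blast
    qed
    ultimately show "M \<in> herm_tensor_sym"
      by simp
  qed
  from 1 2 show ?thesis by blast
qed

end

theory Submission imports Defs begin

text \<open>For hermitian matrices with symmetric blocks the partial transpose is the complex conjugate,
  so the PPT condition is just positive semidefiniteness. By the range criterion, if \<open>M \<noteq> 0\<close> is
  separable then some nonzero product vector \<open>a \<otimes> b\<close> with \<open>b\<close> real lies in the range of \<open>M\<close>. Real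
  product vectors in \<open>\<complex>\<^sup>8\<close> form a family of real dimension 5, while membership in a range of complex
  rank 5 imposes 6 real equations, so one looks for a matrix of rank 5 whose range avoids them all.

  Take \<open>M = (I, C; C\<^sup>*, C\<^sup>* C + w w\<^sup>*)\<close> with \<open>C = P + \<i> Q\<close>, where \<open>P\<close>, \<open>Q\<close> are real symmetric. The
  lower right block is real iff \<open>Im (w w\<^sup>*) = - [P, Q]\<close>, which is possible when \<open>[P, Q]\<close>
  has rank 2. The matrices chosen have \<open>[P, Q] = 2 (e\<^sub>1 e\<^sub>2\<^sup>T - e\<^sub>2 e\<^sub>1\<^sup>T)\<close> and \<open>w = \<surd>2 (e\<^sub>1 + \<i> e\<^sub>2)\<close> up to
  a phase.\<close>

section \<open>Hermitian forms and the PPT condition\<close>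

definition quad :: "complex^'n^'n \<Rightarrow> complex^'n \<Rightarrow> complex" where
  "quad A v = (\<Sum>i\<in>UNIV. \<Sum>j\<in>UNIV. cnj (v $ i) * A $ i $ j * v $ j)"

lemma herm_psd_iff: "A \<in> herm_psd \<longleftrightarrow> A \<in> herm \<and> (\<forall>v. 0 \<le> Re (quad A v))"
  by (simp add: herm_psd_def quad_def matrix_vector_mult_def sum_distrib_left mult.assoc)

lemma quad_add: "quad (A + B) v = quad A v + quad B v"
  by (simp add: quad_def algebra_simps sum.distrib)

lemma quad_sum: "quad (\<Sum>l\<in>L. A l) v = (\<Sum>l\<in>L. quad (A l) v)"
proof (induction L rule: infinite_finite_induct)
  case (insert x F)
  then show ?case by (simp add: quad_add)
qed (simp_all add: quad_def)

lemma herm_psd_add: "A \<in> herm_psd \<Longrightarrow> B \<in> herm_psd \<Longrightarrow> A + B \<in> herm_psd"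
  unfolding herm_psd_iff herm_def mem_Collect_eq
  by (metis (no_types, lifting) complex_cnj_add add_nonneg_nonneg plus_complex.sel(1) quad_add
      vector_add_component)

lemma herm_psd_sum: "(\<And>l. l \<in> L \<Longrightarrow> A l \<in> herm_psd) \<Longrightarrow> (\<Sum>l\<in>L. A l) \<in> herm_psd"
proof (induction L rule: infinite_finite_induct)
  case (insert x F)
  then show ?case by (simp add: herm_psd_add)
qed (simp_all add: herm_psd_iff quad_def herm_def)

text \<open>The conjugate sits on the row index, so the associated form is the squared modulus of
  the linear functional with coefficients \<open>f\<close>.\<close>

definition rank_one :: "complex^'n \<Rightarrow> complex^'n^'n" where
  "rank_one f = (\<chi> i j. cnj (f $ i) * f $ j)"

lemma quad_rank_one: "quad (rank_one f) v = of_real ((cmod (\<Sum>i\<in>UNIV. f $ i * v $ i))\<^sup>2)"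
  unfolding complex_norm_square
  by (simp add: quad_def rank_one_def sum_distrib_left sum_distrib_right mult_ac)

lemma rank_one_psd: "rank_one f \<in> herm_psd"
  by (simp add: herm_psd_iff quad_rank_one) (simp add: herm_def rank_one_def)

lemma herm_tensor_sym_ppt:
  assumes "M \<in> herm_tensor_sym" "M \<in> herm_psd"
  shows "ppt M"
proof -
  have h: "M $ q $ p = cnj (M $ p $ q)" for p q
    using assms(2) unfolding herm_psd_def herm_def by blast
  have s: "M $ (i, k) $ (j, l) = M $ (i, l) $ (j, k)" for i j k l
    using assms(1) unfolding herm_tensor_sym_iff block_def transpose_def vec_eq_iff
      vec_lambda_beta by blast
  have pt: "partial_transpose M $ p $ q = cnj (M $ p $ q)" for p q
    using h[of p q] s[of "fst q" "snd q" "fst p" "snd p"]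
    by (simp add: partial_transpose_def block_def)
  \<comment> \<open>Conjugating a matrix amounts to conjugating its test vectors, so positivity
    carries over.\<close>
  have "quad (partial_transpose M) v = cnj (quad M (\<chi> p. cnj (v $ p)))" for v
    by (simp add: quad_def pt)
  moreover have "partial_transpose M \<in> herm"
    unfolding herm_def mem_Collect_eq pt by (metis h)
  ultimately show ?thesis
    using assms(2) by (simp add: ppt_def herm_psd_iff)
qed

section \<open>Null vectors of real semidefinite forms\<close>

text \<open>If \<open>y = B *v x\<close> were nonzero, the form at \<open>x + t *\<^sub>R y\<close>
  would have linear term \<open>2 * t * (y \<bullet> y)\<close> and no constant term, hence be
  negative for small negative \<open>t\<close>.\<close>

lemma sym_psd_kernel:
  assumes B: "B \<in> sym_psd" and x: "x \<bullet> (B *v x) = 0"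
  shows "B *v x = 0"
proof (rule ccontr)
  define y where "y = B *v x"
  define m where "m = y \<bullet> (B *v y)"
  assume "B *v x \<noteq> 0"
  then have c: "y \<bullet> y > 0" by (simp add: y_def)
  have sym: "transpose B = B" and psd: "0 \<le> v \<bullet> (B *v v)" for v
    using B by (auto simp: sym_psd_def sym_real_def)
  have "x \<bullet> (B *v y) = y \<bullet> y"
    by (metis dot_lmul_matrix sym vector_transpose_matrix y_def)
  then have "(x + t *\<^sub>R y) \<bullet> (B *v (x + t *\<^sub>R y)) = 2 * t * (y \<bullet> y) + t\<^sup>2 * m" for t
    using x by (simp add: matrix_vector_right_distrib matrix_vector_mult_scaleR inner_add_left
        inner_add_right m_def power2_eq_square algebra_simps flip: y_def)
  then have *: "0 \<le> 2 * t * (y \<bullet> y) + t\<^sup>2 * m" for t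
    using psd by metis
  have m: "m \<ge> 0" using psd by (simp add: m_def)
  \<comment> \<open>The denominator \<open>m + 1\<close> instead of \<open>m\<close> also covers
    \<open>m = 0\<close>.\<close>
  have "2 * (- (y \<bullet> y) / (m + 1)) * (y \<bullet> y) + (- (y \<bullet> y) / (m + 1))\<^sup>2 * m
      = - ((y \<bullet> y)\<^sup>2 * (m + 2) / (m + 1)\<^sup>2)"
    using m by (simp add: divide_simps power2_eq_square) (simp add: algebra_simps)
  moreover have "(y \<bullet> y)\<^sup>2 * (m + 2) / (m + 1)\<^sup>2 > 0"
    using m c by (intro divide_pos_pos mult_pos_pos) auto
  ultimately show False
    using *[of "- (y \<bullet> y) / (m + 1)"] by linarith
qed

text \<open>Complex arguments are needed because contracting a vector with a complex first tensor
  factor leaves a complex vector.\<close>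

definition cquad :: "real^'m^'m \<Rightarrow> complex^'m \<Rightarrow> real" where
  "cquad B u = Re (\<Sum>k\<in>UNIV. \<Sum>l\<in>UNIV. cnj (u $ k) * of_real (B $ k $ l) * u $ l)"

text \<open>As \<open>B\<close> is real, mixed products of real and imaginary parts contribute only
  to the imaginary part.\<close>

lemma cquad_alt:
  "cquad B u = (\<chi> k. Re (u $ k)) \<bullet> (B *v (\<chi> k. Re (u $ k)))
             + (\<chi> k. Im (u $ k)) \<bullet> (B *v (\<chi> k. Im (u $ k)))"
  by (simp add: cquad_def inner_vec_def matrix_vector_mult_def sum_distrib_left sum.distrib
      mult_ac)

lemma cquad_nonneg: "B \<in> sym_psd \<Longrightarrow> 0 \<le> cquad B u"
  by (simp add: cquad_alt sym_psd_def)

lemma cquad_kernel: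
  assumes B: "B \<in> sym_psd" and u: "cquad B u = 0"
  shows "(\<Sum>l\<in>UNIV. of_real (B $ k $ l) * u $ l) = 0"
proof -
  have "0 \<le> v \<bullet> (B *v v)" for v
    using B by (simp add: sym_psd_def)
  then have "(\<chi> k. Re (u $ k)) \<bullet> (B *v (\<chi> k. Re (u $ k))) = 0"
    "(\<chi> k. Im (u $ k)) \<bullet> (B *v (\<chi> k. Im (u $ k))) = 0"
    using u unfolding cquad_alt by (metis add_nonneg_eq_0_iff)+
  then have "B *v (\<chi> k. Re (u $ k)) = 0" "B *v (\<chi> k. Im (u $ k)) = 0"
    using sym_psd_kernel B by blast+
  then show ?thesis
    by (simp add: complex_eq_iff vec_eq_iff matrix_vector_mult_def)
qed

section \<open>The range criterion for separable matrices\<close>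

text \<open>Cholesky factorization, used to reduce the first tensor factor to rank one.\<close>

lemma herm_psd_2_decomposition:
  fixes A :: "complex^2^2"
  assumes "A \<in> herm_psd"
  obtains a d where "\<And>i j. A $ i $ j = a $ i * cnj (a $ j) + d $ i * cnj (d $ j)"
proof -
  have h: "A $ i $ j = cnj (A $ j $ i)" for i j
    using assms unfolding herm_psd_def herm_def by blast
  define p r z where "p = Re (A $ 1 $ 1)" and "r = Re (A $ 2 $ 2)" and "z = A $ 1 $ 2"
  have A: "A $ 1 $ 1 = of_real p" "A $ 2 $ 2 = of_real r" "A $ 1 $ 2 = z" "A $ 2 $ 1 = cnj z"
    using h[of 1 1] h[of 2 2] h[of 2 1] by (auto simp: p_def r_def z_def complex_eq_iff)
  have psd: "0 \<le> Re (quad A v)" for v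
    using assms by (simp add: herm_psd_iff)
  have q: "0 \<le> p * (cmod x)\<^sup>2 + r * (cmod y)\<^sup>2 + 2 * Re (cnj x * z * y)" for x y
    using psd[of "vector [x, y]"]
    by (simp add: quad_def sum_2 A cmod_def power2_eq_square algebra_simps)
  have p0: "p \<ge> 0" using q[of 1 0] by simp
  have r0: "r \<ge> 0" using q[of 0 1] by simp
  show ?thesis
  proof (cases "p = 0")
    case True
    have "z = 0"
    proof (rule ccontr)
      assume z: "z \<noteq> 0"
      \<comment> \<open>Chosen so that the form takes the value -1 at
        \<open>(s z, 1)\<close>.\<close>
      define s where "s = - (r + 1) / (2 * (cmod z)\<^sup>2)"
      have "Re (cnj (of_real s * z) * z * 1) = s * (cmod z)\<^sup>2"
        by (simp add: cmod_power2) (simp add: power2_eq_square algebra_simps)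
      also have "\<dots> = - (r + 1) / 2"
        using z by (simp add: s_def)
      finally show False
        using q[of "of_real s * z" 1] True r0 by simp
    qed
    moreover have "complex_of_real (sqrt r) * of_real (sqrt r) = of_real r"
      using r0 by (simp flip: of_real_mult)
    ultimately have "\<forall>i j. A $ i $ j = (0 :: complex^2) $ i * cnj ((0 :: complex^2) $ j)
        + (vector [0, of_real (sqrt r)] :: complex^2) $ i
          * cnj ((vector [0, of_real (sqrt r)] :: complex^2) $ j)"
      using True by (simp add: forall_2 A)
    then show ?thesis
      using that by blast
  next
    case False
    then have p: "p > 0" using p0 by simp
    \<comment> \<open>The Schur complement of \<open>p\<close>; the form at \<open>(-z, p)\<close>
      is \<open>p\<^sup>2 * e\<close>.\<close>
    define e where "e = r - (cmod z)\<^sup>2 / p"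
    have "Re (cnj (- z) * z * of_real p) = - p * (cmod z)\<^sup>2"
      by (simp add: cmod_power2) (simp add: power2_eq_square algebra_simps)
    then have "0 \<le> p * (cmod z)\<^sup>2 + r * p\<^sup>2 - 2 * p * (cmod z)\<^sup>2"
      using q[of "- z" "of_real p"] p by simp
    also have "\<dots> = p\<^sup>2 * e"
      using p by (simp add: e_def power2_eq_square field_simps)
    finally have e: "e \<ge> 0"
      using p by (simp add: zero_le_mult_iff)
    have sp: "complex_of_real (sqrt p) * of_real (sqrt p) = of_real p"
      using p by (simp flip: of_real_mult)
    have se: "complex_of_real (sqrt e) * of_real (sqrt e) = of_real e"
      using e by (simp flip: of_real_mult)
    have ez: "cnj z * z / of_real p + of_real e = of_real r"
      by (simp add: e_def complex_norm_square mult.commute flip: of_real_power)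
    let ?a = "vector [of_real (sqrt p), cnj z / of_real (sqrt p)] :: complex^2"
    let ?d = "vector [0, of_real (sqrt e)] :: complex^2"
    have "\<forall>i j. A $ i $ j = ?a $ i * cnj (?a $ j) + ?d $ i * cnj (?d $ j)"
      using p sp se ez by (simp add: forall_2 A)
    then show ?thesis
      using that by blast
  qed
qed

lemma sum_UNIV_prod:
  "(\<Sum>p\<in>(UNIV :: ('a::finite \<times> 'b::finite) set). f p) = (\<Sum>i\<in>UNIV. \<Sum>k\<in>UNIV. f (i, k))"
  by (simp add: sum.cartesian_product UNIV_Times_UNIV[symmetric] del: UNIV_Times_UNIV)

lemma quad_kron_rank_one:
  assumes "\<And>i j. A $ i $ j = a $ i * cnj (a $ j) + d $ i * cnj (d $ j)"
  shows "Re (quad (A \<otimes>\<^sub>K B) v) = cquad B (\<chi> l. \<Sum>j\<in>UNIV. cnj (a $ j) * v $ (j, l))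
           + cquad B (\<chi> l. \<Sum>j\<in>UNIV. cnj (d $ j) * v $ (j, l))"
proof -
  have 1: "(\<Sum>i\<in>UNIV. \<Sum>k\<in>UNIV. \<Sum>j\<in>UNIV. \<Sum>l\<in>UNIV.
        cnj (v $ (i, k)) * (c $ i * cnj (c $ j) * of_real (B $ k $ l)) * v $ (j, l))
      = (\<Sum>k\<in>UNIV. \<Sum>l\<in>UNIV. cnj (\<Sum>i\<in>UNIV. cnj (c $ i) * v $ (i, k)) * of_real (B $ k $ l)
          * (\<Sum>j\<in>UNIV. cnj (c $ j) * v $ (j, l)))" (is "?L = ?R") for c
  proof -
    have "?R = (\<Sum>k\<in>UNIV. \<Sum>l\<in>UNIV. \<Sum>i\<in>UNIV. \<Sum>j\<in>UNIV.
        cnj (v $ (i, k)) * (c $ i * cnj (c $ j) * of_real (B $ k $ l)) * v $ (j, l))"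
      by (simp add: sum_distrib_left sum_distrib_right mult_ac)
    also have "\<dots> = (\<Sum>k\<in>UNIV. \<Sum>i\<in>UNIV. \<Sum>l\<in>UNIV. \<Sum>j\<in>UNIV.
        cnj (v $ (i, k)) * (c $ i * cnj (c $ j) * of_real (B $ k $ l)) * v $ (j, l))"
      by (intro sum.cong refl sum.swap)
    also have "\<dots> = (\<Sum>i\<in>UNIV. \<Sum>k\<in>UNIV. \<Sum>l\<in>UNIV. \<Sum>j\<in>UNIV.
        cnj (v $ (i, k)) * (c $ i * cnj (c $ j) * of_real (B $ k $ l)) * v $ (j, l))"
      by (rule sum.swap)
    also have "\<dots> = ?L"
      by (intro sum.cong refl sum.swap)
    finally show ?thesis ..
  qed
  have "quad (A \<otimes>\<^sub>K B) v = (\<Sum>i\<in>UNIV. \<Sum>k\<in>UNIV. \<Sum>j\<in>UNIV. \<Sum>l\<in>UNIV.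
        cnj (v $ (i, k)) * (a $ i * cnj (a $ j) * of_real (B $ k $ l)) * v $ (j, l))
      + (\<Sum>i\<in>UNIV. \<Sum>k\<in>UNIV. \<Sum>j\<in>UNIV. \<Sum>l\<in>UNIV.
        cnj (v $ (i, k)) * (d $ i * cnj (d $ j) * of_real (B $ k $ l)) * v $ (j, l))"
    by (simp add: quad_def sum_UNIV_prod kron_def assms algebra_simps sum.distrib)
  then show ?thesis
    unfolding 1 by (simp add: cquad_def)
qed

text \<open>The range criterion in dual form. All summands are PSD, so a null vector of
  \<open>M\<close> is null for each of them, and any nonzero summand yields the product functional.
  The pairing is bilinear: the vector in the range is the conjugate of \<open>a\<close> tensored
  with \<open>b\<close>.\<close>

lemma separable_product_vector:
  fixes M :: "complex^(2 \<times> 'm::finite)^(2 \<times> 'm)"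
  assumes "separable M" "M \<noteq> 0"
  obtains a :: "complex^2" and b :: "real^'m" where "a \<noteq> 0" "b \<noteq> 0"
    "\<And>v. quad M v = 0 \<Longrightarrow> (\<Sum>j\<in>UNIV. \<Sum>l\<in>UNIV. a $ j * of_real (b $ l) * v $ (j, l)) = 0"
proof -
  obtain r A B where AB: "\<And>l. l < r \<Longrightarrow> A l \<in> herm_psd \<and> B l \<in> sym_psd"
    and M: "M = (\<Sum>l<(r::nat). A l \<otimes>\<^sub>K B l)"
    using assms(1) unfolding separable_def by blast
  have "\<exists>l<r. A l \<otimes>\<^sub>K B l \<noteq> 0"
    using assms(2) unfolding M by (metis (no_types, lifting) lessThan_iff sum.neutral)
  then obtain l where l: "l < r" "A l \<otimes>\<^sub>K B l \<noteq> 0" by blast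
  have nonneg: "0 \<le> Re (quad (A l \<otimes>\<^sub>K B l) v)" if "l < r" for l v
  proof -
    have "A l \<in> herm_psd" and B: "B l \<in> sym_psd"
      using AB that by auto
    then obtain a d where "\<And>i j. A l $ i $ j = a $ i * cnj (a $ j) + d $ i * cnj (d $ j)"
      by (metis herm_psd_2_decomposition)
    then show ?thesis
      by (simp add: quad_kron_rank_one cquad_nonneg[OF B])
  qed
  have zero: "Re (quad (A l \<otimes>\<^sub>K B l) v) = 0" if "quad M v = 0" for v
  proof -
    have "(\<Sum>l<r. Re (quad (A l \<otimes>\<^sub>K B l) v)) = 0"
      using that unfolding M quad_sum by (metis Re_sum zero_complex.sel(1))
    then show ?thesis
      using nonneg l(1) by (subst (asm) sum_nonneg_eq_0_iff) auto
  qed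
  obtain a d where ad: "\<And>i j. A l $ i $ j = a $ i * cnj (a $ j) + d $ i * cnj (d $ j)"
    using AB[OF l(1)] by (metis herm_psd_2_decomposition)
  have Bl: "B l \<in> sym_psd" using AB l(1) by blast
  obtain i j k k' where ne: "A l $ i $ j \<noteq> 0" "B l $ k $ k' \<noteq> 0"
    using l(2) by (auto simp: vec_eq_iff kron_def)
  have orth: "(\<Sum>j\<in>UNIV. \<Sum>m\<in>UNIV. cnj (c $ j) * of_real (B l $ k $ m) * v $ (j, m)) = 0"
    if "c = a \<or> c = d" "quad M v = 0" for c v
  proof -
    have "cquad (B l) (\<chi> m. \<Sum>j\<in>UNIV. cnj (a $ j) * v $ (j, m)) = 0 \<and>
          cquad (B l) (\<chi> m. \<Sum>j\<in>UNIV. cnj (d $ j) * v $ (j, m)) = 0"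
      using zero[OF that(2)] unfolding quad_kron_rank_one[OF ad]
      by (simp only: add_nonneg_eq_0_iff cquad_nonneg[OF Bl])
    then have "cquad (B l) (\<chi> m. \<Sum>j\<in>UNIV. cnj (c $ j) * v $ (j, m)) = 0"
      using that(1) by blast
    from cquad_kernel[OF Bl this, of k] show ?thesis
      by (subst sum.swap) (simp add: sum_distrib_left mult_ac)
  qed
  have "a \<noteq> 0 \<or> d \<noteq> 0"
    using ne(1) ad[of i j] by auto
  then obtain c where c: "c = a \<or> c = d" "c \<noteq> 0"
    by blast
  show ?thesis
  \<comment> \<open>By \<open>cquad_kernel\<close> every row of \<open>B l\<close> annihilates the
    contracted null vector; a nonzero row serves as the real factor.\<close>
  proof (rule that[of "\<chi> j. cnj (c $ j)" "B l $ k"])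
    show "(\<chi> j. cnj (c $ j)) \<noteq> 0" using c(2) by (auto simp: vec_eq_iff)
    show "B l $ k \<noteq> 0" using ne(2) by auto
  qed (use orth[OF c(1)] in simp)
qed

section \<open>The entangled PPT matrix\<close>

definition C :: "complex^4^4" where
  "C = vector [vector [1, 2 * \<i>, 1, 2 * \<i>],
               vector [2 * \<i>, 0, 2 * \<i>, 1],
               vector [1, 2 * \<i>, -1, 0],
               vector [2 * \<i>, 1, 0, 0]]"

definition row_form :: "4 \<Rightarrow> complex^(2 \<times> 4)" where
  "row_form r = (\<chi> p. if fst p = 1 then mat 1 $ r $ snd p else C $ r $ snd p)"

text \<open>The functional \<open>(p, q) \<mapsto> w\<^sup>* q\<close>, with the phase of \<open>w\<close> chosen to make the entries Gaussian integers.\<close>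

definition extra_form :: "complex^(2 \<times> 4)" where
  "extra_form = (\<chi> p. if fst p = 1 then 0 else vector [1 + \<i>, 1 - \<i>, 0, 0] $ snd p)"

text \<open>On a vector with blocks p, q the form is |p + C q|^2 + |w* q|^2, a sum of squares of
  five functionals.\<close>

definition witness :: "complex^(2 \<times> 4)^(2 \<times> 4)" where
  "witness = (\<Sum>r\<in>UNIV. rank_one (row_form r)) + rank_one extra_form"

lemma vector_4_nth:
  "(vector [a, b, c, d] :: 'a::zero^4) $ 1 = a" "(vector [a, b, c, d] :: 'a^4) $ 2 = b"
  "(vector [a, b, c, d] :: 'a^4) $ 3 = c" "(vector [a, b, c, d] :: 'a^4) $ 4 = d"
  by (simp_all add: vector_def)

lemma witness_psd: "witness \<in> herm_psd"
  unfolding witness_def by (intro herm_psd_add herm_psd_sum rank_one_psd)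

lemma witness_herm_tensor_sym: "witness \<in> herm_tensor_sym"
proof -
  have "\<forall>i j k l. witness $ (i, l) $ (j, k) = witness $ (i, k) $ (j, l)"
    by (simp add: forall_2 forall_4 witness_def rank_one_def row_form_def extra_form_def
        C_def sum_4 vector_4_nth mat_def algebra_simps)
  then show ?thesis
    using witness_psd unfolding herm_tensor_sym_iff
    by (simp add: herm_psd_iff block_def transpose_def vec_eq_iff)
qed

text \<open>All five functionals vanish at (-C q, q) once w* q = 0, which gives a complex
  3-dimensional family of null vectors.\<close>

lemma witness_kernel:
  assumes "(1 + \<i>) * q $ 1 + (1 - \<i>) * q $ 2 = 0"
  shows "quad witness (\<chi> p. if fst p = 1 then - (C *v q) $ snd p else q $ snd p) = 0"
    (is "quad _ ?v = 0")
proof -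
  have "(\<Sum>p\<in>UNIV. row_form r $ p * ?v $ p) = 0" for r
  proof -
    have "(\<Sum>p\<in>UNIV. row_form r $ p * ?v $ p)
        = (\<Sum>k\<in>UNIV. mat 1 $ r $ k * - (C *v q) $ k) + (\<Sum>k\<in>UNIV. C $ r $ k * q $ k)"
      by (simp add: sum_UNIV_prod sum_2 row_form_def)
    also have "(\<Sum>k\<in>UNIV. mat 1 $ r $ k * - (C *v q) $ k) = - (C *v q) $ r"
      by (simp add: mat_def if_distrib[of "\<lambda>x. x * _"] sum_negf cong: if_cong)
    finally show ?thesis
      by (simp add: matrix_vector_mult_def)
  qed
  moreover have "(\<Sum>p\<in>UNIV. extra_form $ p * ?v $ p) = 0"
    using assms by (simp add: sum_UNIV_prod sum_2 sum_4 extra_form_def vector_4_nth)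
  ultimately show ?thesis
    by (simp add: witness_def quad_add quad_sum quad_rank_one del: vec_lambda_beta)
qed

text \<open>Three independent null vectors give three complex, hence six real, equations in
  \<open>b\<close> and the ratio of the entries of \<open>a\<close>; these force
  \<open>b = 0\<close>.\<close>

lemma no_product_vector:
  fixes a :: "complex^2" and b :: "real^4"
  assumes "a \<noteq> 0"
    and orth: "\<And>v. quad witness v = 0 \<Longrightarrow>
      (\<Sum>j\<in>UNIV. \<Sum>l\<in>UNIV. a $ j * of_real (b $ l) * v $ (j, l)) = 0"
  shows "b = 0"
proof -
  have eq: "a $ 2 * (\<Sum>l\<in>UNIV. of_real (b $ l) * q $ l)
      = a $ 1 * (\<Sum>l\<in>UNIV. of_real (b $ l) * (C *v q) $ l)"
    if "(1 + \<i>) * q $ 1 + (1 - \<i>) * q $ 2 = 0" for q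
    using orth[OF witness_kernel[OF that]]
    by (simp add: sum_2 sum_distrib_left sum_negf mult_ac)
  define b1 b2 b3 b4 where b: "b1 = b $ 1" "b2 = b $ 2" "b3 = b $ 3" "b4 = b $ 4"
  note simps = sum_4 vector_4_nth matrix_vector_mult_def C_def algebra_simps
  \<comment> \<open>The vectors \<open>q\<close> used here and in the next two equations form a
    basis of the solutions of w* q = 0.\<close>
  have 3: "a $ 2 * of_real b3 = a $ 1 * (of_real (b1 - b3) + \<i> * of_real (2 * b2))"
    using eq[of "vector [0, 0, 1, 0]"] by (simp add: simps flip: b)
  have 4: "a $ 2 * of_real b4 = a $ 1 * (of_real b2 + \<i> * of_real (2 * b1))"
    using eq[of "vector [0, 0, 0, 1]"] by (simp add: simps flip: b)
  have 12: "a $ 2 * (of_real b1 - \<i> * of_real b2)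
      = a $ 1 * (of_real (3 * b1 + 3 * b3) + \<i> * of_real (2 * b2 + b4))"
    using eq[of "vector [1, - \<i>, 0, 0]"] by (simp add: simps flip: b)
  have "b1 = 0 \<and> b2 = 0 \<and> b3 = 0 \<and> b4 = 0"
  proof (cases "a $ 1 = 0")
    case True
    then have "a $ 2 \<noteq> 0"
      using assms(1) by (auto simp: vec_eq_iff forall_2)
    then have "b3 = 0" "b4 = 0" "of_real b1 - \<i> * of_real b2 = 0"
      using 3 4 12 True by simp_all
    then show ?thesis
      by (simp add: complex_eq_iff)
  next
    case False
    \<comment> \<open>Only the ratio \<open>a $ 2 / a $ 1\<close> matters; since \<open>b\<close> is
      real, real and imaginary parts separate into the six equations \<open>e\<close>.\<close>
    define s t where "s = Re (a $ 2 / a $ 1)" "t = Im (a $ 2 / a $ 1)"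
    have a2: "a $ 2 = a $ 1 * Complex s t"
      using False by (simp add: s_t_def)
    have "Complex s t * of_real b3 = of_real (b1 - b3) + \<i> * of_real (2 * b2)"
      "Complex s t * of_real b4 = of_real b2 + \<i> * of_real (2 * b1)"
      "Complex s t * (of_real b1 - \<i> * of_real b2)
        = of_real (3 * b1 + 3 * b3) + \<i> * of_real (2 * b2 + b4)"
      using 3 4 12 False unfolding a2 mult.assoc mult_cancel_left by blast+
    then have e: "s * b3 = b1 - b3" "t * b3 = 2 * b2" "s * b4 = b2" "t * b4 = 2 * b1"
      "s * b1 + t * b2 = 3 * b1 + 3 * b3" "t * b1 - s * b2 = 2 * b2 + b4"
      by (simp_all add: complex_eq_iff)
    show ?thesis
    proof (cases "b3 = 0 \<or> b4 = 0")
      case True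
      then show ?thesis using e by auto
    next
      case False
      \<comment> \<open>Eliminating \<open>b1\<close> and \<open>b2\<close> makes each remaining
        equation a multiple of \<open>b3\<close> or \<open>b4\<close>, which cancels and leaves
        polynomial conditions on \<open>s\<close> and \<open>t\<close>.\<close>
      have x: "b1 = (1 + s) * b3" "b2 = s * b4" "t * b3 = 2 * (s * b4)" "t * b4 = 2 * ((1 + s) * b3)"
        using e by (simp_all add: algebra_simps)
      have "t\<^sup>2 * b3 = 4 * s * (1 + s) * b3"
        using x(3,4) by algebra
      then have t: "t\<^sup>2 = 4 * s * (1 + s)"
        using False by simp
      have "2 * s * (1 + s) * b4 = (1 + s)\<^sup>2 * b4"
        using e(6) x by algebra
      then have s: "2 * s * (1 + s) = (1 + s)\<^sup>2"
        using False by simp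
      have "(2 * (s - 3) * (1 + s) + t\<^sup>2) * b3 = 6 * b3"
        using e(5) x by algebra
      then have "2 * (s - 3) * (1 + s) + t\<^sup>2 = 6"
        using False by simp
      \<comment> \<open>By \<open>s\<close>, the number \<open>s\<close> is 1 or -1; with
        \<open>t\<close> the left side of the last equation is then 0, not 6.\<close>
      with t s have False by algebra
      then show ?thesis ..
    qed
  qed
  then show ?thesis
    by (simp add: b vec_eq_iff forall_4)
qed

theorem theorem6p1:
  "Gamma44 \<noteq> Sigma44 \<and>
   (\<exists>M :: complex^(2 \<times> 4)^(2 \<times> 4). M \<in> herm_tensor_sym \<and> ppt M \<and> \<not> separable M)"
proof -
  have "witness $ (1, 1) $ (1, 1) = 1"
    by (simp add: witness_def rank_one_def row_form_def extra_form_def sum_4 mat_def)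
  then have "witness \<noteq> 0" by auto
  have "\<not> separable witness"
  proof
    assume "separable witness"
    then show False
    proof (rule separable_product_vector[OF _ \<open>witness \<noteq> 0\<close>])
      fix a :: "complex^2" and b :: "real^4"
      assume ab: "a \<noteq> 0" "b \<noteq> 0" and orth: "\<And>v. quad witness v = 0 \<Longrightarrow>
        (\<Sum>j\<in>UNIV. \<Sum>l\<in>UNIV. a $ j * of_real (b $ l) * v $ (j, l)) = 0"
      have "b = 0"
        by (rule no_product_vector[OF ab(1) orth])
      with ab(2) show False ..
    qed
  qed
  moreover have "ppt witness"
    using herm_tensor_sym_ppt witness_herm_tensor_sym witness_psd by blast
  ultimately show ?thesis
    using witness_herm_tensor_sym unfolding Gamma44_def Sigma44_def by blast
qed

end
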